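(* A commutative, infinite idempotent semifield $K$ is algebraically closed if and only if every polynomial $p \in K[X]$ is closable.
   Context: A semiring is a commutative monoid $(S,+,0)$ with an associative multiplication having identity $1$, distributing over $+$, and with $0$ absorbing. A semifield is a semiring with $1\neq 0$ in which every nonzero element has a multiplicative inverse; it is idempotent if $x+x=x$ for all $x$. All idempotent semifields are assumed commutative and infinite. An idempotent semifield $K$ is ordered by $x\leqslant y \iff x+y=y$. $K^*=K\setminus\{0\}$, $\mathbb{N}$ contains $0$, and $x^0=1$ for all $x\in K$. A polynomial $p\in K[X]$ is a formal polynomial $p=\sum_{j\in\mathbb{N}}p_jX^j$ (eventually zero sequence of coefficients). Its polynomial function is $\widehat p:K\to K$, $\widehat p(x)=\sum_j p_jx^j$. $p$ is closable if for every $j\in\mathbb{N}$ the set $\{\widehat p(x)x^{-j}:x\in K^*\}$ has an infimum in $K$. $K$ is algebraically closed if for every $p\in K[X]$ of degree $n>0$ the polynomial function $\widehat p$ splits in $K$, i.e. there are $r_1,\dots,r_n\in K$ with $\widehat p(x)=p_n(x+r_1)\cdots(x+r_n)$ for all $x\in K$. *)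

theory Defs
  imports "HOL-Computational_Algebra.Polynomial" "HOL-Library.Lub_Glb"
begin

text \<open>
  The order and the inverse are parameters of the class, but \<open>idem_le_iff\<close>, \<open>idem_less_iff\<close> and
  the inverse axioms determine them from the semiring structure; \<open>inverse 0 = 0\<close> is a mere
  convention, as in class \<open>field\<close>.
\<close>

class idempotent_semifield = comm_semiring_1 + inverse + ord +
  assumes idem_add: "x + x = x"
    and idem_left_inverse: "x \<noteq> 0 \<Longrightarrow> inverse x * x = 1"
    and idem_divide_inverse: "x / y = x * inverse y"
    and idem_inverse_zero: "inverse 0 = 0"
    and idem_le_iff: "x \<le> y \<longleftrightarrow> x + y = y"
    and idem_less_iff: "x < y \<longleftrightarrow> x \<le> y \<and> x \<noteq> y"
begin

subclass order
proof
  fix x y z :: 'a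
  show "x < y \<longleftrightarrow> x \<le> y \<and> \<not> y \<le> x"
    by (auto simp: idem_less_iff idem_le_iff add.commute)
  show "x \<le> x"
    by (simp add: idem_le_iff idem_add)
  show "x \<le> z" if "x \<le> y" "y \<le> z"
    using that by (metis idem_le_iff add.assoc)
  show "x = y" if "x \<le> y" "y \<le> x"
    using that by (simp add: idem_le_iff add.commute)
qed

end

definition closable :: "'a::idempotent_semifield poly \<Rightarrow> bool" where
  "closable p \<longleftrightarrow> (\<forall>j::nat. \<exists>m. isGlb UNIV {poly p x * inverse x ^ j | x. x \<noteq> 0} m)"

text \<open>Splitting concerns the polynomial function \<^term>\<open>poly p\<close>, not the formal polynomial.\<close>

definition splits :: "'a::idempotent_semifield poly \<Rightarrow> bool" where
  "splits p \<longleftrightarrow> (\<exists>r::nat \<Rightarrow> 'a. \<forall>x. poly p x = lead_coeff p * (\<Prod>i=1..degree p. x + r i))"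

definition algebraically_closed :: "'a::idempotent_semifield itself \<Rightarrow> bool" where
  "algebraically_closed _ \<longleftrightarrow> (\<forall>p::'a poly. degree p > 0 \<longrightarrow> splits p)"

end

(* Write the infimum of p(x) x^(-j) over nonzero x as c_j. If p splits, its roots can be sorted into
   a decreasing chain s_1, ..., s_n; then c_(n-k) = p_n s_1 ... s_k, attained at x = s_k when s_k is
   nonzero, and equal to 0 otherwise because the infimum of K^* is 0 in an infinite K.
   Conversely, if all c_j exist, then p(x) is the sum of the c_j x^j with j <= n. The exchange
   inequality c_i c_(j+1) <= c_(i+1) c_j for i < j makes the quotients c_(j-1) / c_j a decreasing
   chain as j descends from n, and the product of the x + c_(j-1) / c_j expands to p(x) / p_n. *)

theory Submission
  imports Defs
begin

\<comment> \<open>Order and arithmetic of idempotent semifields\<close>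
subclass (in idempotent_semifield) canonically_ordered_monoid_add
proof
  fix a b :: 'a
  show "a \<le> b \<longleftrightarrow> (\<exists>c. b = a + c)"
    \<comment> \<open>Forward, \<open>b\<close> itself is the witness for \<open>c\<close>;
      backward, a + (a + c) = a + c by idempotence.\<close>
    unfolding idem_le_iff by (metis add.assoc idem_add)
qed

subclass (in idempotent_semifield) ordered_comm_semiring
proof
  fix a b c :: 'a
  assume "a \<le> b"
  then show "c * a \<le> c * b"
    unfolding idem_le_iff by (metis distrib_left)
qed

subclass (in idempotent_semifield) ordered_semiring_1
  by standard (simp add: less_le)

lemma (in idempotent_semifield) idem_right_inverse: "x \<noteq> 0 \<Longrightarrow> x * inverse x = 1"
  using idem_left_inverse by (simp add: mult.commute)

\<comment> \<open>Provides \<open>power_not_zero\<close>, on which later cancellations of powers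
  rest.\<close>
subclass (in idempotent_semifield) semiring_1_no_zero_divisors
proof
  fix a b :: 'a
  assume "a \<noteq> 0" "b \<noteq> 0"
  then show "a * b \<noteq> 0"
    by (metis idem_left_inverse mult.assoc mult_1_left mult_zero_right)
qed

subclass (in idempotent_semifield) semiring_no_zero_divisors_cancel
proof
  fix a b c :: 'a
  show *: "a * c = b * c \<longleftrightarrow> c = 0 \<or> a = b"
    by (metis idem_right_inverse mult.assoc mult_1_right mult_zero_right)
  show "c * a = c * b \<longleftrightarrow> c = 0 \<or> a = b"
    using * by (simp add: mult.commute)
qed

context idempotent_semifield
begin

lemma idem_inverse_nonzero: "x \<noteq> 0 \<Longrightarrow> inverse x \<noteq> 0"
  by (metis idem_right_inverse mult_zero_right zero_neq_one)

lemma idem_inverse_inverse: "inverse (inverse x) = x"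
  by (metis idem_inverse_nonzero idem_inverse_zero idem_left_inverse idem_right_inverse
      mult_cancel_left)

lemma idem_power_inverse: "x \<noteq> 0 \<Longrightarrow> x ^ n * inverse x ^ n = 1"
  by (metis idem_right_inverse power_mult_distrib power_one)

lemma idem_power_inverse_le:
  assumes "x \<noteq> 0" "i \<le> j"
  shows "inverse x ^ i * x ^ j = x ^ (j - i)"
proof -
  have "x ^ j = x ^ i * x ^ (j - i)"
    using assms by (simp flip: power_add)
  then show ?thesis
    using idem_power_inverse[OF assms(1), of i]
    by (metis mult.assoc mult.commute mult_1_left)
qed

lemma idem_add_upper: "a \<le> a + b" "b \<le> a + b"
  by (simp_all add: add_increasing2 add_increasing)

lemma idem_add_least: "a \<le> c \<Longrightarrow> b \<le> c \<Longrightarrow> a + b \<le> c"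
  using add_mono[of a c b c] idem_add by simp

lemma idem_add_absorb: "a \<le> b \<Longrightarrow> a + b = b" "a \<le> b \<Longrightarrow> b + a = b"
  by (simp_all add: idem_le_iff add.commute)

lemma idem_sum_least: "(\<And>i. i \<in> A \<Longrightarrow> f i \<le> b) \<Longrightarrow> sum f A \<le> b"
  by (induction A rule: infinite_finite_induct) (auto intro: idem_add_least)

lemma idem_mult_mono: "a \<le> b \<Longrightarrow> c \<le> d \<Longrightarrow> a * c \<le> b * d"
  by (simp add: mult_mono)

lemma idem_mult_le_cancel_right:
  assumes "a * c \<le> b * c" "c \<noteq> 0"
  shows "a \<le> b"
proof -
  have "a * c * inverse c \<le> b * c * inverse c"
    using assms by (simp add: idem_mult_mono)
  then show ?thesis
    using assms by (simp add: mult.assoc idem_right_inverse)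
qed

lemma idem_le_mult_inverse:
  assumes "c \<noteq> 0"
  shows "a \<le> b * inverse c \<longleftrightarrow> a * c \<le> b"
proof
  assume "a \<le> b * inverse c"
  then have "a * c \<le> b * inverse c * c"
    by (simp add: idem_mult_mono)
  then show "a * c \<le> b"
    using assms by (simp add: mult.assoc idem_left_inverse)
next
  assume "a * c \<le> b"
  then have "a * c * inverse c \<le> b * inverse c"
    by (simp add: idem_mult_mono)
  then show "a \<le> b * inverse c"
    using assms by (simp add: mult.assoc idem_right_inverse)
qed

lemma idem_mult_inverse_le:
  assumes "c \<noteq> 0"
  shows "a * inverse c \<le> b \<longleftrightarrow> a \<le> b * c"
  using idem_le_mult_inverse[OF idem_inverse_nonzero[OF assms], of a b]
  by (simp add: idem_inverse_inverse)

text \<open>Turns a lower bound l of p(x) x^(-j) into the division-free inequality l x^j \<le>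
  p(x).\<close>

lemma idem_le_mult_inverse_power:
  assumes "c \<noteq> 0"
  shows "a \<le> b * inverse c ^ n \<longleftrightarrow> a * c ^ n \<le> b"
proof -
  have "inverse c ^ n = inverse (c ^ n)"
    using assms idem_power_inverse[OF assms, of n] idem_right_inverse[of "c ^ n"]
    by (metis mult_cancel_left power_not_zero)
  then show ?thesis
    using assms by (simp add: idem_le_mult_inverse)
qed

text \<open>
  The order need not be total, so \<open>a ^ k \<le> b ^ k \<Longrightarrow> a \<le> b\<close> is derived by cancelling a power of
  \<open>a + b\<close> in the following inequality.
\<close>

lemma idem_power_add_le: "(a + b) ^ Suc k \<le> b * (a + b) ^ k + a ^ Suc k"
proof (induction k)
  case 0
  then show ?case by (simp add: add.commute)
next
  case (Suc k)
  have "a * (a + b) ^ Suc k \<le> a * (b * (a + b) ^ k + a ^ Suc k)"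
    by (rule idem_mult_mono[OF order_refl Suc])
  also have "\<dots> = b * (a * (a + b) ^ k) + a ^ Suc (Suc k)"
    by (simp add: algebra_simps)
  also have "\<dots> \<le> b * (a + b) ^ Suc k + a ^ Suc (Suc k)"
    by (intro add_mono order_refl idem_mult_mono) (simp add: idem_mult_mono idem_add_upper)
  finally have "a * (a + b) ^ Suc k \<le> b * (a + b) ^ Suc k + a ^ Suc (Suc k)" .
  then have "b * (a + b) ^ Suc k + a * (a + b) ^ Suc k
      \<le> b * (a + b) ^ Suc k + a ^ Suc (Suc k)"
    by (intro idem_add_least idem_add_upper)
  then show ?case
    by (simp add: algebra_simps)
qed

lemma idem_power_le_imp_le:
  assumes "a ^ Suc k \<le> b ^ Suc k"
  shows "a \<le> b"
proof (cases "a + b = 0")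
  case True
  then show ?thesis
    using idem_add_upper(1)[of a b] by simp
next
  case False
  have "b ^ Suc k \<le> b * (a + b) ^ k"
    by (simp add: idem_mult_mono idem_add_upper power_mono)
  then have "(a + b) * (a + b) ^ k \<le> b * (a + b) ^ k"
    using idem_power_add_le[of a b k] assms
    by (metis idem_add_least order_refl order_trans power_Suc)
  then have "a + b \<le> b"
    using False by (metis idem_mult_le_cancel_right power_not_zero)
  then show ?thesis
    using idem_add_upper(1) order_trans by blast
qed

end

section \<open>Limits at zero and at infinity\<close>

text \<open>This replaces letting x tend to 0. If \<open>a\<close> is nonzero, x = a / (a + C)
  already gives C x \<le> a, so the error term is absorbed. If \<open>a = 0\<close>, a nonzero
  \<open>m\<close> would bound all inverses of admissible x by C / m, which is impossible in an
  infinite semifield.\<close>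

lemma le_of_le_add_small:
  fixes m a C :: "'a::idempotent_semifield"
  assumes inf: "infinite (UNIV :: 'a set)"
    and le: "\<And>x. x \<noteq> 0 \<Longrightarrow> x \<le> 1 \<Longrightarrow> m \<le> a + C * x"
  shows "m \<le> a"
proof (cases "a = 0")
  case False
  define s where "s = a + C"
  have s: "s \<noteq> 0" "a \<le> s" "C \<le> s"
    using False idem_add_upper[where a = a and b = C] unfolding s_def by auto
  have "C * a \<le> a * s"
    using idem_mult_mono[OF s(3) order_refl, of a] by (simp add: mult.commute)
  then have "C * (a * inverse s) \<le> a"
    using s by (simp add: idem_mult_inverse_le flip: mult.assoc)
  moreover have "a * inverse s \<le> 1"
    using s by (simp add: idem_mult_inverse_le)
  ultimately show ?thesis
    using le[of "a * inverse s"] False s idem_inverse_nonzero idem_add_absorb(2) by fastforce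
next
  case True
  show ?thesis
  proof (rule ccontr)
    assume "\<not> m \<le> a"
    with True have m: "m \<noteq> 0" by auto
    \<comment> \<open>Infinity of K enters only here: any element other than 0 and 1 yields some g >
      1, namely its inverse if it lies below 1, and its sum with 1 otherwise.\<close>
    obtain b :: 'a where b: "b \<noteq> 0" "b \<noteq> 1"
      using inf by (metis UNIV_I finite.emptyI finite_insert insertCI finite_subset subsetI)
    obtain g :: 'a where g: "1 \<le> g" "g \<noteq> 1"
    proof (cases "b \<le> 1")
      case True
      then have "1 \<le> inverse b"
        using idem_le_mult_inverse[of b 1 1] b by simp
      moreover have "inverse b \<noteq> 1"
        using b idem_right_inverse by fastforce
      ultimately show ?thesis using that by blast
    next
      case False
      then show ?thesis
        using that[of "b + 1"] by (metis idem_add_upper)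
    qed
    \<comment> \<open>The inverse of \<open>y\<close> is an admissible x, and the hypothesis at this
      point reads y \<le> t. The summand 1 makes the factor \<open>1 + t\<close> nonzero, so it can
      be cancelled to give g \<le> 1.\<close>
    define t where "t = C * inverse m"
    define y where "y = (1 + t) * g"
    have t: "1 \<le> 1 + t" "t \<le> 1 + t" by (rule idem_add_upper)+
    then have "1 \<le> y" unfolding y_def using g idem_mult_mono by fastforce
    then have y: "y \<noteq> 0" by auto
    have "inverse y \<le> 1"
      using idem_mult_inverse_le[OF y, of 1 1] \<open>1 \<le> y\<close> by simp
    then have "m \<le> C * inverse y"
      using le[of "inverse y"] True idem_inverse_nonzero[OF y] by simp
    then have "y \<le> t"
      unfolding t_def using y m by (simp add: idem_le_mult_inverse mult.commute)
    then have "g * (1 + t) \<le> 1 * (1 + t)"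
      using t y_def by (simp add: mult.commute)
    moreover have "1 + t \<noteq> 0" using t(1) by auto
    ultimately have "g \<le> 1"
      by (rule idem_mult_le_cancel_right)
    with g show False by simp
  qed
qed

text \<open>Let x tend to infinity: with x = 1/z and z \<le> 1, every term of index i < j carries a
  positive power of z and is bounded by a constant times z.\<close>

lemma poly_inf_high:
  fixes p :: "'a::idempotent_semifield poly"
  assumes inf: "infinite (UNIV :: 'a set)" and j: "degree p \<le> j"
    and le: "\<And>x. x \<noteq> 0 \<Longrightarrow> m \<le> poly p x * inverse x ^ j"
  shows "m \<le> coeff p j"
proof (rule le_of_le_add_small[OF inf])
  fix z :: 'a
  assume z: "z \<noteq> 0" "z \<le> 1"
  have "m \<le> poly p (inverse z) * z ^ j"
    using le[of "inverse z"] z by (simp add: idem_inverse_nonzero idem_inverse_inverse)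
  also have "\<dots> = (\<Sum>i\<le>degree p. coeff p i * z ^ (j - i))"
    unfolding poly_altdef sum_distrib_right using z j
    by (intro sum.cong) (auto simp: mult.assoc idem_power_inverse_le)
  also have "\<dots> \<le> coeff p j + (\<Sum>i\<le>degree p. coeff p i) * z"
  proof (rule idem_sum_least)
    fix i assume i: "i \<in> {..degree p}"
    show "coeff p i * z ^ (j - i) \<le> coeff p j + (\<Sum>i\<le>degree p. coeff p i) * z"
    proof (cases "i = j")
      case True
      then show ?thesis by (simp add: idem_add_upper)
    next
      case False
      have "z ^ (j - i) \<le> z"
        using power_decreasing[of 1 "j - i" z] z i j False by simp
      moreover have "coeff p i \<le> (\<Sum>i\<le>degree p. coeff p i)"
        using i by (intro member_le_sum) auto
      ultimately have "coeff p i * z ^ (j - i) \<le> (\<Sum>i\<le>degree p. coeff p i) * z"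
        by (simp add: idem_mult_mono)
      then show ?thesis
        using idem_add_upper(2) order_trans by blast
    qed
  qed
  finally show "m \<le> coeff p j + (\<Sum>i\<le>degree p. coeff p i) * z" .
qed

text \<open>Let x tend to 0: all terms but the constant one are bounded by a constant times
  x.\<close>

lemma poly_inf_zero:
  fixes p :: "'a::idempotent_semifield poly"
  assumes inf: "infinite (UNIV :: 'a set)"
    and le: "\<And>x. x \<noteq> 0 \<Longrightarrow> m \<le> poly p x"
  shows "m \<le> coeff p 0"
proof (rule le_of_le_add_small[OF inf])
  fix z :: 'a
  assume z: "z \<noteq> 0" "z \<le> 1"
  have "m \<le> poly p z"
    using le z by simp
  also have "\<dots> \<le> coeff p 0 + (\<Sum>i\<le>degree p. coeff p i) * z"
    unfolding poly_altdef
  proof (rule idem_sum_least)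
    fix i assume i: "i \<in> {..degree p}"
    show "coeff p i * z ^ i \<le> coeff p 0 + (\<Sum>i\<le>degree p. coeff p i) * z"
    proof (cases "i = 0")
      case True
      then show ?thesis by (simp add: idem_add_upper)
    next
      case False
      have "z ^ i \<le> z"
        using power_decreasing[of 1 i z] z False by simp
      moreover have "coeff p i \<le> (\<Sum>i\<le>degree p. coeff p i)"
        using i by (intro member_le_sum) auto
      ultimately have "coeff p i * z ^ i \<le> (\<Sum>i\<le>degree p. coeff p i) * z"
        by (simp add: idem_mult_mono)
      then show ?thesis
        using idem_add_upper(2) order_trans by blast
    qed
  qed
  finally show "m \<le> coeff p 0 + (\<Sum>i\<le>degree p. coeff p i) * z" .
qed

lemma coeff_mult_power_le_poly:
  fixes p :: "'a::idempotent_semifield poly"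
  shows "coeff p j * x ^ j \<le> poly p x"
proof (cases "j \<le> degree p")
  case True
  then show ?thesis
    unfolding poly_altdef by (intro member_le_sum[where f = "\<lambda>i. coeff p i * x ^ i"]) auto
next
  case False
  then show ?thesis by (simp add: coeff_eq_0)
qed

lemma isGlb_poly_iff:
  fixes p :: "'a::idempotent_semifield poly"
  shows "isGlb UNIV {poly p x * inverse x ^ j | x. x \<noteq> 0} m \<longleftrightarrow>
    (\<forall>x. x \<noteq> 0 \<longrightarrow> m \<le> poly p x * inverse x ^ j) \<and>
    (\<forall>l. (\<forall>x. x \<noteq> 0 \<longrightarrow> l \<le> poly p x * inverse x ^ j) \<longrightarrow> l \<le> m)"
  by (auto simp: isGlb_def isLb_def greatestP_def setge_def setle_def)

text \<open>From the degree upwards the infimum exists for every polynomial, so closability is a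
  condition on exponents below the degree only.\<close>

lemma isGlb_coeff_high:
  fixes p :: "'a::idempotent_semifield poly"
  assumes "infinite (UNIV :: 'a set)" "degree p \<le> j"
  shows "isGlb UNIV {poly p x * inverse x ^ j | x. x \<noteq> 0} (coeff p j)"
  unfolding isGlb_poly_iff
  using assms poly_inf_high[OF assms]
  by (auto simp: idem_le_mult_inverse_power coeff_mult_power_le_poly)

section \<open>Products of linear factors and sorting of roots\<close>

text \<open>The coefficient of x^(n-k) is an elementary symmetric function of the roots. As the
  roots decrease, its summand made of the first k roots dominates all others.\<close>

lemma prod_add_antimono_expand:
  fixes s :: "nat \<Rightarrow> 'a::idempotent_semifield"
  assumes "antimono s"
  shows "(\<Prod>i<n. x + s i) = (\<Sum>k\<le>n. (\<Prod>i<k. s i) * x ^ (n - k))"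
proof (induction n)
  case 0
  then show ?case by simp
next
  case (Suc n)
  let ?R = "\<lambda>k. \<Prod>i<k. s i"
  let ?A = "\<Sum>k\<le>n. ?R k * x ^ (Suc n - k)"
  have "(\<Prod>i<Suc n. x + s i) = (\<Sum>k\<le>n. ?R k * x ^ (n - k)) * (x + s n)"
    using Suc by simp
  also have "\<dots> = ?A + (\<Sum>k\<le>n. ?R k * x ^ (n - k) * s n)"
    unfolding distrib_left sum_distrib_right
    by (auto intro!: arg_cong2[where f = "(+)"] sum.cong simp: Suc_diff_le mult_ac)
  also have "\<dots> = ?A + ?R (Suc n)"
  proof (rule antisym)
    have "(\<Sum>k\<le>n. ?R k * x ^ (n - k) * s n) \<le> ?A + ?R (Suc n)"
    proof (rule idem_sum_least)
      fix k assume k: "k \<in> {..n}"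
      show "?R k * x ^ (n - k) * s n \<le> ?A + ?R (Suc n)"
      proof (cases "k = n")
        case True
        then show ?thesis by (simp add: idem_add_upper)
      next
        case False
        with k have k: "k < n" by simp
        \<comment> \<open>Raising \<open>s n\<close> to \<open>s k\<close> turns this product into
          the next summand of \<open>?A\<close>, which absorbs it; only k = n contributes something
          new.\<close>
        have "?R k * x ^ (n - k) * s n \<le> ?R k * x ^ (n - k) * s k"
          using assms k by (intro idem_mult_mono) (auto simp: monotone_def)
        also have "\<dots> = ?R (Suc k) * x ^ (Suc n - Suc k)"
          by (simp add: mult_ac)
        also have "\<dots> \<le> ?A"
          using k by (intro member_le_sum[where f = "\<lambda>k. ?R k * x ^ (Suc n - k)"]) auto
        finally show ?thesis
          using idem_add_upper(1) order_trans by blast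
      qed
    qed
    then show "?A + (\<Sum>k\<le>n. ?R k * x ^ (n - k) * s n) \<le> ?A + ?R (Suc n)"
      by (intro idem_add_least idem_add_upper)
    have "?R n * x ^ (n - n) * s n \<le> (\<Sum>k\<le>n. ?R k * x ^ (n - k) * s n)"
      by (intro member_le_sum[where f = "\<lambda>k. ?R k * x ^ (n - k) * s n"]) auto
    then show "?A + ?R (Suc n) \<le> ?A + (\<Sum>k\<le>n. ?R k * x ^ (n - k) * s n)"
      by (intro add_mono) simp_all
  qed
  also have "\<dots> = (\<Sum>k\<le>Suc n. ?R k * x ^ (Suc n - k))"
    by simp
  finally show ?case .
qed

text \<open>
  The infimum of \<open>a\<close> and \<open>b\<close> is \<open>a * b * inverse (a + b)\<close>; replacing two roots by their
  supremum and infimum does not change the product, so roots can be sorted by insertion.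
\<close>

lemma exchange_roots:
  fixes a b :: "'a::idempotent_semifield"
  obtains q where "q \<le> a" "q \<le> b" "\<And>x. (x + a) * (x + b) = (x + (a + b)) * (x + q)"
proof (cases "a + b = 0")
  case True
  then have "a = 0" "b = 0"
    using idem_add_upper[where a = a and b = b] by auto
  then show ?thesis using that[of 0] by simp
next
  case False
  define q where "q = a * b * inverse (a + b)"
  have "a * b \<le> a * (a + b)" "a * b \<le> b * (a + b)"
    using idem_mult_mono[OF order_refl idem_add_upper(1), of b a b]
    by (simp_all add: idem_mult_mono idem_add_upper mult.commute)
  then have q: "q \<le> a" "q \<le> b"
    unfolding q_def idem_mult_inverse_le[OF False] .
  have q2: "(a + b) * q = a * b"
    unfolding q_def using False
    by (metis idem_left_inverse mult.assoc mult.commute mult_1_right)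
  have "(x + a) * (x + b) = (x + (a + b)) * (x + q)" for x
  proof -
    have "(x + (a + b)) * (x + q) = x * x + ((a + b) + q) * x + (a + b) * q"
      by (simp add: algebra_simps)
    also have "(a + b) + q = a + b"
      using q by (meson idem_add_absorb(2) idem_add_upper(1) order_trans)
    finally show ?thesis
      unfolding q2 by (simp add: algebra_simps)
  qed
  then show ?thesis using that q by blast
qed

text \<open>The clause on upper bounds \<open>b\<close> strengthens the induction: after the head
  \<open>s\<close> is exchanged for \<open>a + s\<close> and \<open>q\<close> is inserted into the
  tail, it shows that the new tail still lies below the head.\<close>

lemma insert_root_sorted:
  fixes ss :: "'a::idempotent_semifield list"
  assumes "sorted_wrt (\<ge>) ss"
  shows "\<exists>ts. length ts = Suc (length ss) \<and> sorted_wrt (\<ge>) ts \<and>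
    (\<forall>b. a \<le> b \<longrightarrow> (\<forall>s\<in>set ss. s \<le> b) \<longrightarrow> (\<forall>t\<in>set ts. t \<le> b)) \<and>
    (\<forall>x. (\<Prod>t\<leftarrow>ts. x + t) = (x + a) * (\<Prod>s\<leftarrow>ss. x + s))"
  using assms
proof (induction ss arbitrary: a)
  case Nil
  then show ?case by (intro exI[of _ "[a]"]) auto
next
  case (Cons s ss)
  obtain q where q: "q \<le> a" "q \<le> s"
    "\<And>x. (x + a) * (x + s) = (x + (a + s)) * (x + q)"
    by (rule exchange_roots[of a s]) blast
  obtain ts where ts: "length ts = Suc (length ss)" "sorted_wrt (\<ge>) ts"
    "\<And>b. q \<le> b \<Longrightarrow> \<forall>s\<in>set ss. s \<le> b \<Longrightarrow> \<forall>t\<in>set ts. t \<le> b"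
    "\<And>x. (\<Prod>t\<leftarrow>ts. x + t) = (x + q) * (\<Prod>s\<leftarrow>ss. x + s)"
    using Cons by fastforce
  have "\<forall>t\<in>set ts. t \<le> s"
    using ts(3)[of s] q Cons.prems by simp
  then have "\<forall>t\<in>set ts. t \<le> a + s"
    using idem_add_upper(2) order_trans by blast
  then have "sorted_wrt (\<ge>) ((a + s) # ts)"
    using ts(2) by simp
  moreover have "\<forall>t\<in>set ((a + s) # ts). t \<le> b" if "a \<le> b" "\<forall>t\<in>set (s # ss). t \<le> b" for b
    using ts(3)[of b] that q(1) by (auto intro: idem_add_least order_trans)
  moreover have "length ((a + s) # ts) = Suc (length (s # ss))"
    using ts(1) by simp
  moreover have "(\<Prod>t\<leftarrow>(a + s) # ts. x + t) = (x + a) * (\<Prod>s\<leftarrow>s # ss. x + s)" for x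
    using q(3)[of x] by (simp add: ts(4) flip: mult.assoc)
  ultimately show ?case
    by blast
qed

lemma sort_roots:
  fixes r :: "nat \<Rightarrow> 'a::idempotent_semifield"
  obtains s where "antimono s" "\<And>x. (\<Prod>i<n. x + r i) = (\<Prod>i<n. x + s i)"
proof -
  have "\<exists>ts. length ts = n \<and> sorted_wrt (\<ge>) ts \<and>
    (\<forall>x. (\<Prod>t\<leftarrow>ts. x + t) = (\<Prod>i<n. x + r i))"
  proof (induction n)
    case 0
    then show ?case by simp
  next
    case (Suc n)
    then show ?case
      using insert_root_sorted[of _ "r n"] by (metis mult.commute prod.lessThan_Suc)
  qed
  then obtain ts where ts: "length ts = n" "sorted_wrt (\<ge>) ts"
    "\<And>x. (\<Prod>t\<leftarrow>ts. x + t) = (\<Prod>i<n. x + r i)"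
    by blast
  \<comment> \<open>Padding with the least element 0 keeps the sequence decreasing on all of
    \<open>nat\<close>.\<close>
  define s where "s i = (if i < n then ts ! i else 0)" for i
  have "antimono s"
  proof
    fix i j :: nat assume "i \<le> j"
    then show "s j \<le> s i"
      using sorted_wrt_nth_less[OF ts(2), of i j] ts(1) unfolding s_def
      by (cases "i = j") auto
  qed
  moreover have "(\<Prod>i<n. x + r i) = (\<Prod>i<n. x + s i)" for x
    unfolding ts(3)[symmetric] prod.list_conv_set_nth
    by (auto simp: ts(1) s_def atLeast0LessThan intro!: prod.cong)
  ultimately show ?thesis using that by blast
qed

text \<open>In each factor the larger summand absorbs the smaller: it is \<open>s i\<close> for i
  \<le> k and \<open>s k\<close> afterwards. Thus at x = \<open>s k\<close> a single term of the
  expansion equals the whole product.\<close>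

lemma prod_add_at_root:
  fixes s :: "nat \<Rightarrow> 'a::idempotent_semifield"
  assumes "antimono s" "Suc k \<le> n"
  shows "(\<Prod>i<n. s k + s i) = (\<Prod>i<Suc k. s i) * s k ^ (n - Suc k)"
  using assms(2)
proof (induction n rule: dec_induct)
  case base
  have "(\<Prod>i<Suc k. s k + s i) = (\<Prod>i<Suc k. s i)"
    using assms(1) by (intro prod.cong idem_add_absorb) (auto simp: monotone_def)
  then show ?case by simp
next
  case (step m)
  have "s k + s m = s k"
    using assms(1) step by (intro idem_add_absorb) (auto simp: monotone_def)
  moreover have "m - k = Suc (m - Suc k)"
    using step by simp
  ultimately show ?case
    using step by (simp add: mult_ac)
qed

section \<open>From splitting to closability\<close>

lemma closable_if_splits:
  fixes p :: "'a::idempotent_semifield poly"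
  assumes inf: "infinite (UNIV :: 'a set)" and "splits p"
  shows "closable p"
  unfolding closable_def
proof
  fix j :: nat
  define n where "n = degree p"
  define a where "a = lead_coeff p"
  show "\<exists>m. isGlb UNIV {poly p x * inverse x ^ j | x. x \<noteq> 0} m"
  proof (cases "n \<le> j")
    case True
    then show ?thesis using isGlb_coeff_high[OF inf] n_def by blast
  next
    case False
    \<comment> \<open>Chosen so that the term of exponent j has the coefficient p_n s_0 ... s_k;
      \<open>s k\<close> is then the point to evaluate at.\<close>
    define k where "k = n - Suc j"
    have k: "Suc k \<le> n" "n - Suc k = j" using False k_def by auto
    obtain r where "\<And>x. poly p x = a * (\<Prod>i=1..n. x + r i)"
      using assms unfolding splits_def n_def a_def by blast
    then have r: "\<And>x. poly p x = a * (\<Prod>i<n. x + r (Suc i))"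
      by (simp add: prod.atLeast1_atMost_eq)
    obtain s where s: "antimono s" "\<And>x. (\<Prod>i<n. x + r (Suc i)) = (\<Prod>i<n. x + s i)"
      using sort_roots[where r = "\<lambda>i. r (Suc i)"] by metis
    have p: "poly p x = a * (\<Prod>i<n. x + s i)" for x
      using r s by simp
    define R where "R t = a * (\<Prod>i<t. s i)" for t
    have pR: "poly p x = (\<Sum>t\<le>n. R t * x ^ (n - t))" for x
      unfolding p prod_add_antimono_expand[OF s(1)] R_def
      by (simp add: sum_distrib_left mult_ac)
    have lower: "R (Suc k) \<le> poly p x * inverse x ^ j" if "x \<noteq> 0" for x
      using that k member_le_sum[of "Suc k" "{..n}" "\<lambda>t. R t * x ^ (n - t)"]
      by (simp add: idem_le_mult_inverse_power pR)
    have "l \<le> R (Suc k)" if l: "\<And>x. x \<noteq> 0 \<Longrightarrow> l \<le> poly p x * inverse x ^ j" for l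
    proof (cases "s k = 0")
      case False
      then have "l * s k ^ j \<le> poly p (s k)"
        using l[of "s k"] by (simp add: idem_le_mult_inverse_power)
      also have "\<dots> = R (Suc k) * s k ^ j"
        unfolding p prod_add_at_root[OF s(1) k(1)] R_def k(2) by (rule mult.assoc[symmetric])
      finally have "l * s k ^ j \<le> R (Suc k) * s k ^ j" .
      then show ?thesis
        using False by (metis idem_mult_le_cancel_right power_not_zero)
    next
      case True
      \<comment> \<open>Now \<open>R t\<close> vanishes for all t > k, so only exponents above j
        survive and p(x) x^(-j) is at most a constant times x for x \<le> 1.\<close>
      show ?thesis
      proof (rule le_of_le_add_small[OF inf])
        fix x :: 'a
        assume x: "x \<noteq> 0" "x \<le> 1"
        have "(\<Sum>t\<le>n. R t * x ^ (n - t)) \<le> (\<Sum>t\<le>n. R t) * x * x ^ j"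
        proof (rule idem_sum_least)
          fix t assume t: "t \<in> {..n}"
          show "R t * x ^ (n - t) \<le> (\<Sum>t\<le>n. R t) * x * x ^ j"
          proof (cases "k < t")
            case True
            then have "R t = 0"
              using \<open>s k = 0\<close> by (auto simp: R_def intro!: prod_zero)
            then show ?thesis by simp
          next
            case False
            have "R t \<le> (\<Sum>t\<le>n. R t)"
              using t by (intro member_le_sum) auto
            moreover have "x ^ (n - t) \<le> x ^ Suc j"
              using False k x by (intro power_decreasing) auto
            ultimately have "R t * x ^ (n - t) \<le> (\<Sum>t\<le>n. R t) * x ^ Suc j"
              by (rule idem_mult_mono)
            then show ?thesis by (simp add: mult_ac)
          qed
        qed
        then have "l * x ^ j \<le> (\<Sum>t\<le>n. R t) * x * x ^ j"
          using l[of x] x by (simp add: idem_le_mult_inverse_power pR)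
        then have "l \<le> (\<Sum>t\<le>n. R t) * x"
          using x by (metis idem_mult_le_cancel_right power_not_zero)
        then show "l \<le> R (Suc k) + (\<Sum>t\<le>n. R t) * x"
          using idem_add_upper(2) order_trans by blast
      qed
    qed
    then show ?thesis
      using lower isGlb_poly_iff by blast
  qed
qed

section \<open>From closability to splitting\<close>

text \<open>Multiplication by a nonzero \<open>a\<close> is an order automorphism and so preserves
  infima; for \<open>a = 0\<close> the point 1 suffices.\<close>

lemma le_mult_glb:
  fixes a c m :: "'a::idempotent_semifield"
  assumes "\<And>x. x \<noteq> 0 \<Longrightarrow> m \<le> a * f x"
    and "\<And>l. (\<And>x. x \<noteq> (0::'a) \<Longrightarrow> l \<le> f x) \<Longrightarrow> l \<le> c"
  shows "m \<le> a * c"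
proof (cases "a = 0")
  case True
  then show ?thesis using assms(1)[of 1] by simp
next
  case False
  then have "m * inverse a \<le> c"
    using assms by (simp add: idem_mult_inverse_le mult.commute)
  then show ?thesis
    using False by (simp add: idem_mult_inverse_le mult.commute)
qed

lemma splits_if_closable:
  fixes p :: "'a::idempotent_semifield poly"
  assumes inf: "infinite (UNIV :: 'a set)" and "closable p" and deg: "degree p > 0"
  shows "splits p"
proof -
  define n where "n = degree p"
  define V where "V j x = poly p x * inverse x ^ j" for j x
  obtain c where "\<forall>j. isGlb UNIV {poly p x * inverse x ^ j | x. x \<noteq> 0} (c j)"
    using choice[OF assms(2)[unfolded closable_def]] by blast
  then have cL: "x \<noteq> 0 \<Longrightarrow> c j \<le> V j x"
    and cG: "(\<And>x. x \<noteq> 0 \<Longrightarrow> l \<le> V j x) \<Longrightarrow> l \<le> c j" for j x l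
    unfolding isGlb_poly_iff V_def by blast+
  have coeff_le: "coeff p j \<le> c j" for j
    by (rule cG) (simp add: V_def idem_le_mult_inverse_power coeff_mult_power_le_poly)
  have c_n: "c n = lead_coeff p"
    using poly_inf_high[OF inf, of p n "c n"] cL[of _ n] coeff_le[of n]
    by (intro antisym) (auto simp: V_def n_def)
  then have c_n0: "c n \<noteq> 0"
    using deg by auto
  \<comment> \<open>The infima range over nonzero x only; this equality extends the bound c_j x^j
    \<le> p(x) to x = 0.\<close>
  have c_0: "c 0 = coeff p 0"
    using poly_inf_zero[OF inf, of "c 0" p] cL[of _ 0] coeff_le[of 0]
    by (intro antisym) (auto simp: V_def)
  have c_le_poly: "c j * x ^ j \<le> poly p x" for j x
  proof (cases "x = 0")
    case True
    then show ?thesis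
      by (cases j) (auto simp: c_0 poly_0_coeff_0)
  next
    case False
    then show ?thesis
      using cL[of x j] by (simp add: V_def idem_le_mult_inverse_power)
  qed
  have poly_c: "poly p x = (\<Sum>j\<le>n. c j * x ^ j)" for x
  proof (rule antisym)
    show "poly p x \<le> (\<Sum>j\<le>n. c j * x ^ j)"
      unfolding poly_altdef n_def by (intro sum_mono idem_mult_mono coeff_le order_refl)
    show "(\<Sum>j\<le>n. c j * x ^ j) \<le> poly p x"
      by (intro idem_sum_least c_le_poly)
  qed
  text \<open>
    Swapping the two evaluation points \<open>x\<close>, \<open>y\<close> bounds the left-hand side by both \<open>D u\<close> and
    \<open>D u^(-d - 1)\<close>, where \<open>u = x / y\<close>; hence its power with exponent \<open>d + 2\<close> is at most that of \<open>D\<close>.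
  \<close>
  have exchange: "c i * c (Suc j) \<le> c (Suc i) * c j" if "i < j" for i j
  proof -
    have "c i * c (Suc j) \<le> V (Suc i) x * V j y" if xy: "x \<noteq> 0" "y \<noteq> 0" for x y
    proof -
      define D where "D = V (Suc i) x * V j y"
      define d where "d = j - Suc i"
      have j: "j = Suc i + d" using \<open>i < j\<close> d_def by simp
      define X where "X = inverse x"
      define Y where "Y = inverse y"
      have X: "x * X = 1" and Y: "y * Y = 1"
        using xy by (simp_all add: X_def Y_def idem_right_inverse)
      let ?m = "c i * c (Suc j)"
      have "?m \<le> V i x * V (Suc j) y"
        using cL xy by (intro idem_mult_mono)
      also have "\<dots> = (x * X) * (V i x * V (Suc j) y)"
        by (simp add: X)
      also have "\<dots> = D * (x * Y)"
        unfolding D_def V_def by (simp add: X_def Y_def mult_ac)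
      finally have 1: "?m \<le> D * (x * Y)" .
      have "?m \<le> V i y * V (Suc j) x"
        using cL xy by (intro idem_mult_mono)
      also have "\<dots> = (y * Y) ^ Suc d * (V i y * V (Suc j) x)"
        by (simp add: Y)
      also have "\<dots> = D * (y * X) ^ Suc d"
        unfolding D_def V_def j by (simp add: X_def Y_def mult_ac power_add power_mult_distrib)
      finally have 2: "?m \<le> D * (y * X) ^ Suc d" .
      have "?m ^ Suc (Suc d) = ?m * ?m ^ Suc d"
        by simp
      also have "\<dots> \<le> (D * (y * X) ^ Suc d) * (D * (x * Y)) ^ Suc d"
        by (rule idem_mult_mono[OF 2 power_mono[OF 1 zero_le]])
      also have "\<dots> = D ^ Suc (Suc d) * ((x * X) * (y * Y)) ^ Suc d"
        by (simp add: mult_ac power_mult_distrib)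
      also have "\<dots> = D ^ Suc (Suc d)"
        by (simp add: X Y)
      finally show ?thesis
        unfolding D_def by (rule idem_power_le_imp_le)
    qed
    \<comment> \<open>Take the infimum over y for fixed x, then over x.\<close>
    then have "c i * c (Suc j) \<le> V (Suc i) x * c j" if "x \<noteq> 0" for x
      using that by (intro le_mult_glb[where f = "V j", OF _ cG])
    then have "c i * c (Suc j) \<le> c j * V (Suc i) x" if "x \<noteq> 0" for x
      using that by (simp add: mult.commute)
    then have "c i * c (Suc j) \<le> c j * c (Suc i)"
      by (rule le_mult_glb[OF _ cG])
    then show ?thesis by (simp add: mult.commute)
  qed
  \<comment> \<open>Descend from the nonzero \<open>c n\<close>: if \<open>c j = 0\<close> but
    c_(j+1) is nonzero, the exchange inequality forces c_i = 0; otherwise the claim for j+1 applies.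
    Hence a zero denominator in the quotients below comes with a zero numerator.\<close>
  have zero_below: "c i = 0" if "i < j" "j \<le> n" "c j = 0" for i j
    using that(2,1,3)
  proof (induction j rule: inc_induct)
    case base
    then show ?case using c_n0 by simp
  next
    case (step j)
    show ?case
    proof (cases "c (Suc j) = 0")
      case True
      then show ?thesis using step by simp
    next
      case False
      then show ?thesis
        using exchange[of i j] step by auto
    qed
  qed
  \<comment> \<open>Consecutive quotients, read from the top coefficient down. Past a vanishing c_j
    they are 0 by the convention on \<open>inverse 0\<close>, and past n by definition, so the
    sequence can decrease on all of \<open>nat\<close>.\<close>
  define r where "r i = (if i < n then c (n - Suc i) * inverse (c (n - i)) else 0)" for i
  have "r (Suc i) \<le> r i" for i
  proof (cases "Suc i < n")
    case False
    then show ?thesis by (simp add: r_def)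
  next
    case True
    define j where "j = n - Suc (Suc i)"
    have eqs: "n - Suc i = Suc j" "n - i = Suc (Suc j)" "n - Suc (Suc i) = j"
      using True j_def by auto
    have j2: "Suc (Suc j) \<le> n"
      using True j_def by auto
    have "c j * inverse (c (Suc j)) \<le> c (Suc j) * inverse (c (Suc (Suc j)))"
    proof (cases "c (Suc j) = 0")
      case True
      then show ?thesis by (simp add: idem_inverse_zero)
    next
      case False
      then have nz: "c (Suc (Suc j)) \<noteq> 0"
        using zero_below[of "Suc j" "Suc (Suc j)"] j2 by auto
      \<comment> \<open>Exchange at the indices j and j+1 is log-concavity: c_j c_(j+2) \<le>
        c_(j+1)^2.\<close>
      have "c j \<le> c (Suc j) * c (Suc j) * inverse (c (Suc (Suc j)))"
        using exchange[of j "Suc j"] nz by (simp add: idem_le_mult_inverse)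
      then show ?thesis
        using False by (simp add: idem_mult_inverse_le mult_ac)
    qed
    then show ?thesis using True by (simp add: r_def eqs)
  qed
  then have r: "antimono r"
    by (simp add: decseq_Suc_iff)
  \<comment> \<open>The product telescopes; where the denominator is 0, \<open>zero_below\<close>
    makes both sides 0.\<close>
  have prod_r: "c n * (\<Prod>i<k. r i) = c (n - k)" if "k \<le> n" for k
    using that
  proof (induction k)
    case 0
    then show ?case by simp
  next
    case (Suc k)
    then have "c n * (\<Prod>i<Suc k. r i) = c (n - k) * r k"
      by (simp flip: mult.assoc)
    also have "\<dots> = c (n - Suc k)"
    proof (cases "c (n - k) = 0")
      case True
      then show ?thesis
        using zero_below[of "n - Suc k" "n - k"] Suc.prems by simp
    next
      case False
      then show ?thesis
        using Suc.prems unfolding r_def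
        by (simp add: mult.left_commute[of "c (n - k)"] idem_right_inverse)
    qed
    finally show ?case .
  qed
  \<comment> \<open>The shift matches the root numbering from 1 in \<open>splits\<close>.\<close>
  have "poly p x = lead_coeff p * (\<Prod>i=1..degree p. x + r (i - 1))" for x
  proof -
    have "lead_coeff p * (\<Prod>i=1..degree p. x + r (i - 1)) = c n * (\<Prod>i<n. x + r i)"
      by (simp add: n_def prod.atLeast1_atMost_eq flip: c_n[unfolded n_def])
    also have "\<dots> = (\<Sum>k\<le>n. c (n - k) * x ^ (n - k))"
      unfolding prod_add_antimono_expand[OF r] sum_distrib_left
      by (intro sum.cong) (auto simp: prod_r simp flip: mult.assoc)
    also have "\<dots> = poly p x"
      unfolding poly_c
      by (rule sum.reindex_bij_witness[of _ "\<lambda>k. n - k" "\<lambda>k. n - k"]) auto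
    finally show ?thesis by simp
  qed
  then show ?thesis
    unfolding splits_def by (intro exI[of _ "\<lambda>i. r (i - 1)"] allI)
qed

theorem corollary5p14:
  assumes "infinite (UNIV :: 'a::idempotent_semifield set)"
  shows "algebraically_closed TYPE('a) \<longleftrightarrow> (\<forall>p::'a poly. closable p)"
proof
  assume closed: "algebraically_closed TYPE('a)"
  show "\<forall>p::'a poly. closable p"
  proof
    fix p :: "'a poly"
    \<comment> \<open>Algebraic closedness speaks of positive degree only; a constant splits as
      itself times the empty product.\<close>
    have "splits p"
    proof (cases "degree p = 0")
      case True
      then obtain a where "p = [:a:]" by (rule degree_eq_zeroE)
      then show ?thesis by (simp add: splits_def)
    next
      case False
      then show ?thesis using closed by (simp add: algebraically_closed_def)
    qed
    then show "closable p" by (rule closable_if_splits[OF assms])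
  qed
next
  assume "\<forall>p::'a poly. closable p"
  then show "algebraically_closed TYPE('a)"
    using splits_if_closable[OF assms] by (simp add: algebraically_closed_def)
qed

end
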